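(* There are infinitely many integers $n\ge 4$ such that the product $$\prod_{k=4}^{n}\Big(\big(k(k-3)\big)^2-2\Big)$$ is a perfect square.
   Context: A perfect square is an integer of the form $y^2$ with $y\in\mathbb{Z}$. *)

theory Defs
  imports Complex_Main "HOL-Computational_Algebra.Nth_Powers"
begin

end

theory Submission
  imports Defs
begin

text \<open>The quartic \<open>(k (k - 3))\<^sup>2 - 2\<close> is reducible over the integers. Its factor
  \<open>k\<^sup>2 - 3 k - \<surd>2\<close> has discriminant \<open>9 + 4 \<surd>2 = (1 + 2 \<surd>2)\<^sup>2\<close> and so equals
  \<open>(k - 2 - \<surd>2) (k - 1 + \<surd>2)\<close>; pairing these linear factors with their conjugates gives two
  integer quadratics which are shifts of each other. With \<open>g j = j\<^sup>2 - 2\<close> the quartic equals \<open>g (k - 2) * g (k - 1)\<close>, so in the product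
  every \<open>g j\<close> with \<open>3 \<le> j \<le> n - 2\<close> occurs twice, and up to a square factor only
  \<open>g 2 * g (n - 1) = 2 * ((n - 1)\<^sup>2 - 2)\<close> survives (lemma \<open>prod_eq_square_times\<close>). For
  \<open>n = 2 a + 1\<close> this is \<open>4 * (2 a\<^sup>2 - 1)\<close>, a square whenever \<open>y\<^sup>2 = 2 a\<^sup>2 - 1\<close>, and this negative
  Pell equation has arbitrarily large solutions (lemma \<open>negative_Pell_unbounded\<close>).\<close>

lemma quartic_splits:
  fixes k :: int
  shows "(k * (k - 3))\<^sup>2 - 2 = ((k - 2)\<^sup>2 - 2) * ((k - 1)\<^sup>2 - 2)"
  by (simp add: power2_eq_square algebra_simps)

lemma prod_eq_square_times:
  fixes n :: int
  assumes "4 \<le> n"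
  shows "(\<Prod>k=4..n. (k * (k - 3))\<^sup>2 - 2) =
    (\<Prod>j=3..n-2. j\<^sup>2 - 2)\<^sup>2 * (2 * ((n - 1)\<^sup>2 - 2))"
  using assms
proof (induction n rule: int_ge_induct)
  case base
  show ?case by simp
next
  case (step n)
  have "{4..n + 1} = insert (n + 1) {4..n}"
    using step.hyps by auto
  then have "(\<Prod>k=4..n+1. (k * (k - 3))\<^sup>2 - 2) =
      (((n + 1) * ((n + 1) - 3))\<^sup>2 - 2) * (\<Prod>k=4..n. (k * (k - 3))\<^sup>2 - 2)"
    by simp
  also have "\<dots> = (((n - 1)\<^sup>2 - 2) * (n\<^sup>2 - 2)) *
      ((\<Prod>j=3..n-2. j\<^sup>2 - 2)\<^sup>2 * (2 * ((n - 1)\<^sup>2 - 2)))"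
    using quartic_splits[of "n + 1"] by (simp add: step.IH)
  also have "\<dots> = (((n - 1)\<^sup>2 - 2) * (\<Prod>j=3..n-2. j\<^sup>2 - 2))\<^sup>2 * (2 * (n\<^sup>2 - 2))"
    by (simp only: power2_eq_square mult_ac)
  also have "((n - 1)\<^sup>2 - 2) * (\<Prod>j=3..n-2. j\<^sup>2 - 2) = (\<Prod>j=3..n+1-2. j\<^sup>2 - 2)"
  proof -
    have "{3..n + 1 - 2} = insert (n - 1) {3..n - 2}"
      using step.hyps by auto
    then show ?thesis by simp
  qed
  finally show ?case by simp
qed

text \<open>Multiplying \<open>y + a \<surd>2\<close> by the unit \<open>3 + 2 \<surd>2\<close> of norm \<open>1\<close> turns a solution into a
  larger one; the starting point is \<open>1 + \<surd>2\<close>.\<close>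

lemma negative_Pell_unbounded:
  "\<exists>y a :: int. 0 < y \<and> int m < a \<and> y\<^sup>2 = 2 * a\<^sup>2 - 1"
proof (induction m)
  case 0
  have "0 < (1::int) \<and> int 0 < 1 \<and> (1::int)\<^sup>2 = 2 * 1\<^sup>2 - 1" by simp
  then show ?case by blast
next
  case (Suc m)
  then obtain y a :: int where ya: "0 < y" "int m < a" "y\<^sup>2 = 2 * a\<^sup>2 - 1"
    by blast
  have "(3 * y + 4 * a)\<^sup>2 - 2 * (2 * y + 3 * a)\<^sup>2 = y\<^sup>2 - 2 * a\<^sup>2"
    by (simp add: power2_eq_square algebra_simps)
  then have "(3 * y + 4 * a)\<^sup>2 = 2 * (2 * y + 3 * a)\<^sup>2 - 1"
    using ya(3) by linarith
  moreover have "0 < 3 * y + 4 * a" "int (Suc m) < 2 * y + 3 * a"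
    using ya(1,2) by auto
  ultimately show ?case by blast
qed

theorem mainTheorem2:
  shows "infinite {n::int. 4 \<le> n \<and> is_square (\<Prod>k=4..n. (k * (k - 3))\<^sup>2 - 2)}"
    (is "infinite ?S")
proof
  assume fin: "finite ?S"
  \<comment> \<open>The summand \<open>2\<close> excludes the solution \<open>a = 1\<close>, for which \<open>n = 3\<close>.\<close>
  obtain y a :: int where a: "int (nat (Max ?S) + 2) < a" and pell: "y\<^sup>2 = 2 * a\<^sup>2 - 1"
    using negative_Pell_unbounded by blast
  define n where "n = 2 * a + 1"
  define Q where "Q = (\<Prod>j=3..n-2. j\<^sup>2 - 2)"
  have n: "4 \<le> n" "Max ?S < n"
    using a unfolding n_def by linarith+
  have "2 * ((n - 1)\<^sup>2 - 2) = (2 * y)\<^sup>2"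
    using pell by (simp add: n_def power_mult_distrib)
  then have "(\<Prod>k=4..n. (k * (k - 3))\<^sup>2 - 2) = (Q * (2 * y))\<^sup>2"
    using prod_eq_square_times[OF n(1)] by (simp add: Q_def power_mult_distrib)
  then have "is_square (\<Prod>k=4..n. (k * (k - 3))\<^sup>2 - 2)"
    by simp
  with n(1) have "n \<in> ?S" by blast
  then have "n \<le> Max ?S" using fin by (rule Max_ge[rotated])
  with n(2) show False by simp
qed

end
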